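(* Let $G$ be a simple (undirected, unweighted) graph on $n$ nodes with Laplacian $L_n$, maximum degree $\Delta$, and $Z_n:=I_n-\tau L_n$ with $0<\tau<1/\Delta$. Let $k<n$ and, for $S\subset\{1,\dots,n\}$ with $|S|=k$ and sufficiently small $\epsilon>0$, set ${}^S\tilde L_n:=L_n-\epsilon\sum_{j\in S}e_je_j^T$ and ${}^S\tilde Z_n:=Z_n+\epsilon\sum_{j\in S}e_je_j^T$. Then the subsets maximizing the smallest eigenvalue of the perturbed Laplacian coincide with the subsets minimizing the largest eigenvalue of the perturbed stochastic matrix: \[\arg\max_{S:\,|S|=k}\lambda_{\min}({}^S\tilde L_n)=\arg\min_{S:\,|S|=k}\lambda_{\max}({}^S\tilde Z_n).\]
   Context: $e_j$ denotes the $j$-th column of $I_n$. The equality is understood as equality of the sets of optimizing subsets $S$. *)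

theory Defs
  imports "Jordan_Normal_Form.Spectral_Radius" "Graph_Theory.Pair_Digraph"
begin

text \<open>
  A simple undirected graph on \<open>n\<close> nodes is a \<^const>\<open>pair_graph\<close> (finite, loop-free, symmetric arc
  relation, no parallel arcs) with vertex set \<open>{..<n}\<close>; nodes are numbered from \<open>0\<close>, as are the
  indices of \<^typ>\<open>real mat\<close>. Each edge is represented by its two opposite arcs, so the degree of a
  node is its out-degree.
\<close>

definition max_degree :: "nat pair_pre_digraph \<Rightarrow> nat" where
  "max_degree G = Max (out_degree (with_proj G) ` pverts G)"

definition degree_mat :: "nat \<Rightarrow> nat pair_pre_digraph \<Rightarrow> real mat" where
  "degree_mat n G = mat n n (\<lambda>(i, j). if i = j then real (out_degree (with_proj G) i) else 0)"

definition adjacency_mat :: "nat \<Rightarrow> nat pair_pre_digraph \<Rightarrow> real mat" where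
  "adjacency_mat n G = mat n n (\<lambda>(i, j). if (i, j) \<in> parcs G then 1 else 0)"

definition laplacian :: "nat \<Rightarrow> nat pair_pre_digraph \<Rightarrow> real mat" where
  "laplacian n G = degree_mat n G - adjacency_mat n G"

definition stochastic_mat :: "nat \<Rightarrow> nat pair_pre_digraph \<Rightarrow> real \<Rightarrow> real mat" where
  "stochastic_mat n G \<tau> = 1\<^sub>m n - \<tau> \<cdot>\<^sub>m laplacian n G"

text \<open>
  \<open>\<Sum>j\<in>S. e\<^sub>j e\<^sub>j\<^sup>T\<close>, written entrywise because matrices of a variable dimension do not form
  a type-class monoid.
\<close>
definition sum_unit_outer :: "nat \<Rightarrow> nat set \<Rightarrow> real mat" where
  "sum_unit_outer n S = mat n n (\<lambda>(a, b). \<Sum>j\<in>S. unit_vec n j $ a * unit_vec n j $ b)"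

definition perturbed_laplacian ::
    "nat \<Rightarrow> nat pair_pre_digraph \<Rightarrow> real \<Rightarrow> nat set \<Rightarrow> real mat" where
  "perturbed_laplacian n G \<epsilon> S = laplacian n G - \<epsilon> \<cdot>\<^sub>m sum_unit_outer n S"

definition perturbed_stochastic_mat ::
    "nat \<Rightarrow> nat pair_pre_digraph \<Rightarrow> real \<Rightarrow> real \<Rightarrow> nat set \<Rightarrow> real mat" where
  "perturbed_stochastic_mat n G \<tau> \<epsilon> S = stochastic_mat n G \<tau> + \<epsilon> \<cdot>\<^sub>m sum_unit_outer n S"

text \<open>
  Intended for symmetric matrices of positive dimension: their eigenvalues are all real, so
  \<^const>\<open>spectrum\<close>, taken over the reals, is the full spectrum, and it is finite and nonempty.
\<close>

definition lambda_min :: "real mat \<Rightarrow> real" where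
  "lambda_min A = Min (spectrum A)"

definition lambda_max :: "real mat \<Rightarrow> real" where
  "lambda_max A = Max (spectrum A)"

end

theory Submission
  imports Defs
begin

text \<open>
  Since \<open>Z + \<epsilon> P\<^sub>S = I - \<tau> (L - (\<epsilon>/\<tau>) P\<^sub>S)\<close> with \<open>P\<^sub>S = \<Sum>j\<in>S. e\<^sub>j e\<^sub>j\<^sup>T\<close>, minimizing
  the largest eigenvalue of the perturbed stochastic matrix at \<open>\<epsilon>\<close> means maximizing
  \<open>f\<^sub>S(\<epsilon>/\<tau>)\<close>, where \<open>f\<^sub>S(\<epsilon>)\<close> is the smallest eigenvalue of \<open>L - \<epsilon> P\<^sub>S\<close>. So the point is that
  the maximizers of \<open>f\<^sub>S(\<epsilon>)\<close> do not depend on \<open>\<epsilon>\<close> near \<open>0\<close>, i.e. that \<open>g = f\<^sub>S - f\<^sub>T\<close> has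
  constant sign to the right of \<open>0\<close>. By the Rayleigh principle \<open>g\<close> is continuous. It is an
  eigenvalue of \<open>(L - \<epsilon> P\<^sub>S) \<otimes> I - I \<otimes> (L - \<epsilon> P\<^sub>T)\<close>, so it satisfies \<open>F(\<epsilon>, g(\<epsilon>)) = 0\<close> for a
  polynomial \<open>F \<noteq> 0\<close>. Write \<open>F = y\<^sup>m Q\<close> with \<open>Q(\<epsilon>, 0) \<noteq> 0\<close> for small \<open>\<epsilon> > 0\<close>. Near a zero of
  \<open>g\<close> in that range \<open>Q(\<epsilon>, g(\<epsilon>)) \<noteq> 0\<close>, which forces \<open>g = 0\<close>; hence the sign of \<open>g\<close> is locally
  constant, and so constant.

  The Rayleigh principle needs no compactness: the largest \<open>m\<close> with \<open>A - m I\<close> positive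
  semidefinite is an eigenvalue of \<open>A\<close>, because a nonsingular positive semidefinite matrix
  dominates a positive multiple of \<open>I\<close>.
\<close>

section \<open>Signs of real algebraic functions\<close>

text \<open>In \<open>poly2 P t y\<close> the coefficients of \<open>P\<close> are polynomials in \<open>t\<close>.\<close>

definition poly2 :: "'a::comm_semiring_1 poly poly \<Rightarrow> 'a \<Rightarrow> 'a \<Rightarrow> 'a" where
  "poly2 P t y = poly (poly P [:y:]) t"

definition algebraic_on :: "'a::comm_ring_1 set \<Rightarrow> ('a \<Rightarrow> 'a) \<Rightarrow> bool" where
  "algebraic_on X g \<longleftrightarrow> (\<exists>P. P \<noteq> 0 \<and> (\<forall>t\<in>X. poly2 P t (g t) = 0))"

lemma poly2_eq_power_mult:
  fixes P :: "'a::idom poly poly"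
  assumes "P \<noteq> 0"
  obtains Q m where "poly Q 0 \<noteq> 0" and "\<And>t y. poly2 P t y = y ^ m * poly2 Q t y"
proof -
  obtain Q where P: "P = [:- 0, 1:] ^ order 0 P * Q" and Q: "\<not> [:- 0, 1:] dvd Q"
    using order_decomp[OF assms, of 0] by blast
  show thesis
  proof (rule that)
    show "poly Q 0 \<noteq> 0"
      using Q by (simp add: poly_eq_0_iff_dvd)
    show "poly2 P t y = y ^ order 0 P * poly2 Q t y" for t y
      unfolding poly2_def by (subst P) simp
  qed
qed

lemma continuous_on_poly2:
  fixes g :: "real \<Rightarrow> real"
  assumes "continuous_on X g"
  shows "continuous_on X (\<lambda>t. poly2 P t (g t))"
  unfolding poly2_def using assms by (induction P) (auto intro!: continuous_intros)

lemma eventually_poly_neq_0_at_within: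
  fixes p :: "real poly"
  assumes "p \<noteq> 0"
  shows "\<forall>\<^sub>F t in at a within X. poly p t \<noteq> 0"
proof -
  have "\<forall>\<^sub>F t in at a within X. \<forall>r\<in>{r. poly p r = 0}. t \<noteq> r"
    using poly_roots_finite[OF assms]
    by (intro eventually_ball_finite ballI eventually_neq_at_within)
  then show ?thesis
    by (rule eventually_mono) blast
qed

lemma sgn_locally_constant_poly2_root:
  fixes g :: "real \<Rightarrow> real"
  assumes cont: "continuous_on X g" and "t \<in> X"
    and root: "\<And>s. s \<in> X \<Longrightarrow> g s = 0 \<or> poly2 Q s (g s) = 0"
    and nonzero: "poly2 Q t 0 \<noteq> 0"
  shows "\<forall>\<^sub>F s in at t within X. sgn (g t) = sgn (g s)"
proof (cases "g t = 0")
  case True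
  have "((\<lambda>s. poly2 Q s (g s)) \<longlongrightarrow> poly2 Q t 0) (at t within X)"
    using continuous_on_poly2[OF cont, of Q] True \<open>t \<in> X\<close> by (auto simp: continuous_on_def)
  then have "\<forall>\<^sub>F s in at t within X. poly2 Q s (g s) \<noteq> 0"
    using nonzero by (rule tendsto_imp_eventually_ne)
  moreover have "\<forall>\<^sub>F s in at t within X. s \<in> X"
    by (simp add: eventually_at_filter)
  ultimately show ?thesis
  proof eventually_elim
    case (elim s)
    then have "g s = 0"
      using root by blast
    with True show ?case
      by simp
  qed
next
  case False
  have lim: "(g \<longlongrightarrow> g t) (at t within X)"
    using cont \<open>t \<in> X\<close> unfolding continuous_on_def by blast
  show ?thesis
  proof (cases "g t > 0")
    case True
    show ?thesis
      using order_tendstoD(1)[OF lim True] by eventually_elim (use True in simp)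
  next
    case False
    with \<open>g t \<noteq> 0\<close> have "g t < 0"
      by simp
    show ?thesis
      using order_tendstoD(2)[OF lim \<open>g t < 0\<close>] by eventually_elim (use \<open>g t < 0\<close> in simp)
  qed
qed

lemma algebraic_on_sgn_eventually_constant:
  fixes g :: "real \<Rightarrow> real"
  assumes "a < b" and cont: "continuous_on {a<..<b} g" and alg: "algebraic_on {a<..<b} g"
  shows "\<exists>c. \<forall>\<^sub>F t in at_right a. sgn (g t) = c"
proof -
  obtain P where "P \<noteq> 0" and root: "\<forall>t\<in>{a<..<b}. poly2 P t (g t) = 0"
    using alg unfolding algebraic_on_def by blast
  obtain Q m where "poly Q 0 \<noteq> 0" and factor: "\<And>t y. poly2 P t y = y ^ m * poly2 Q t y"
    using poly2_eq_power_mult[OF \<open>P \<noteq> 0\<close>] by blast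
  have "\<forall>\<^sub>F t in at_right a. poly2 Q t 0 \<noteq> 0"
    using eventually_poly_neq_0_at_within[OF \<open>poly Q 0 \<noteq> 0\<close>] by (simp add: poly2_def)
  then obtain d where "a < d" and nonzero: "\<And>t. a < t \<Longrightarrow> t < d \<Longrightarrow> poly2 Q t 0 \<noteq> 0"
    unfolding eventually_at_right_field by blast
  define I where "I = {a<..<min b d}"
  have "I \<subseteq> {a<..<b}"
    by (auto simp: I_def)
  have "\<forall>\<^sub>F s in at t within I. sgn (g t) = sgn (g s)" if "t \<in> I" for t
  proof (rule sgn_locally_constant_poly2_root[OF _ that])
    show "continuous_on I g"
      using cont \<open>I \<subseteq> {a<..<b}\<close> by (rule continuous_on_subset)
    show "g s = 0 \<or> poly2 Q s (g s) = 0" if "s \<in> I" for s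
      using root \<open>I \<subseteq> {a<..<b}\<close> that factor[of s "g s"] by auto
    show "poly2 Q t 0 \<noteq> 0"
      using that nonzero by (simp add: I_def)
  qed
  then have const: "sgn (g s) = sgn (g t)" if "s \<in> I" "t \<in> I" for s t
    using connected_local_const[of I s t "\<lambda>t. sgn (g t)"] that by (simp add: I_def)
  have "a < min b d"
    using \<open>a < b\<close> \<open>a < d\<close> by simp
  then obtain s where "s \<in> I"
    using dense[of a "min b d"] by (auto simp: I_def)
  have "\<forall>\<^sub>F t in at_right a. t \<in> I"
    unfolding I_def using \<open>a < min b d\<close> by (rule eventually_at_right_real)
  then have "\<forall>\<^sub>F t in at_right a. sgn (g t) = sgn (g s)"
    by (rule eventually_mono) (rule const[OF _ \<open>s \<in> I\<close>])
  then show ?thesis ..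
qed

section \<open>Kronecker products and differences of eigenvalues\<close>

definition kronecker_mat :: "'a::times mat \<Rightarrow> 'a mat \<Rightarrow> 'a mat" where
  "kronecker_mat A B = mat (dim_row A * dim_row B) (dim_col A * dim_col B)
     (\<lambda>(p, q). A $$ (p div dim_row B, q div dim_col B) * B $$ (p mod dim_row B, q mod dim_col B))"

definition kronecker_vec :: "'a::times vec \<Rightarrow> 'a vec \<Rightarrow> 'a vec" where
  "kronecker_vec u v = vec (dim_vec u * dim_vec v)
     (\<lambda>p. u $ (p div dim_vec v) * v $ (p mod dim_vec v))"

lemma kronecker_mat_carrier [simp]:
  "A \<in> carrier_mat m m' \<Longrightarrow> B \<in> carrier_mat n n' \<Longrightarrow> kronecker_mat A B \<in> carrier_mat (m * n) (m' * n')"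
  by (simp add: kronecker_mat_def)

lemma kronecker_vec_carrier [simp]:
  "u \<in> carrier_vec m \<Longrightarrow> v \<in> carrier_vec n \<Longrightarrow> kronecker_vec u v \<in> carrier_vec (m * n)"
  by (simp add: kronecker_vec_def)

lemma div_mod_less_mult:
  fixes p m n :: nat
  assumes "p < m * n"
  shows "p div n < m" and "p mod n < n"
  using assms by (auto simp: less_mult_imp_div_less intro!: mod_less_divisor gr0I)

lemma sum_div_mod:
  fixes f :: "nat \<Rightarrow> nat \<Rightarrow> 'a::comm_monoid_add"
  shows "(\<Sum>p<m * n. f (p div n) (p mod n)) = (\<Sum>i<m. \<Sum>j<n. f i j)"
proof -
  have "(\<Sum>p<m * n. f (p div n) (p mod n)) = (\<Sum>i<m. \<Sum>p = i * n..<i * n + n. f (p div n) (p mod n))"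
    by (simp add: sum.nat_group)
  also have "\<dots> = (\<Sum>i<m. \<Sum>j<n. f i j)"
    by (simp add: sum.atLeastLessThan_shift_0 atLeast0LessThan)
  finally show ?thesis .
qed

lemma kronecker_mat_mult_kronecker_vec:
  fixes A B :: "'a::comm_semiring_0 mat"
  assumes A: "A \<in> carrier_mat m m'" and B: "B \<in> carrier_mat n n'"
    and u: "u \<in> carrier_vec m'" and v: "v \<in> carrier_vec n'"
  shows "kronecker_mat A B *\<^sub>v kronecker_vec u v = kronecker_vec (A *\<^sub>v u) (B *\<^sub>v v)"
proof (rule eq_vecI)
  fix p
  assume "p < dim_vec (kronecker_vec (A *\<^sub>v u) (B *\<^sub>v v))"
  then have p: "p < m * n"
    using A B by (simp add: kronecker_vec_def)
  let ?i = "p div n" and ?j = "p mod n"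
  have "(kronecker_mat A B *\<^sub>v kronecker_vec u v) $ p =
      (\<Sum>q<m' * n'. (A $$ (?i, q div n') * B $$ (?j, q mod n')) * (u $ (q div n') * v $ (q mod n')))"
    using p A B u v
    by (simp add: kronecker_mat_def kronecker_vec_def scalar_prod_def atLeast0LessThan)
  also have "\<dots> = (\<Sum>k<m'. \<Sum>l<n'. (A $$ (?i, k) * B $$ (?j, l)) * (u $ k * v $ l))"
    by (rule sum_div_mod)
  also have "\<dots> = (\<Sum>k<m'. A $$ (?i, k) * u $ k) * (\<Sum>l<n'. B $$ (?j, l) * v $ l)"
    by (simp add: sum_product mult_ac)
  also have "\<dots> = kronecker_vec (A *\<^sub>v u) (B *\<^sub>v v) $ p"
    using p A B u v div_mod_less_mult[OF p]
    by (simp add: kronecker_vec_def scalar_prod_def atLeast0LessThan)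
  finally show "(kronecker_mat A B *\<^sub>v kronecker_vec u v) $ p = kronecker_vec (A *\<^sub>v u) (B *\<^sub>v v) $ p" .
qed (use A B in \<open>simp add: kronecker_mat_def kronecker_vec_def\<close>)

lemma kronecker_vec_smult_left:
  fixes u v :: "'a::semigroup_mult vec"
  shows "kronecker_vec (a \<cdot>\<^sub>v u) v = a \<cdot>\<^sub>v kronecker_vec u v"
  by (intro eq_vecI) (auto simp: kronecker_vec_def div_mod_less_mult mult.assoc)

lemma kronecker_vec_smult_right:
  fixes u v :: "'a::comm_semiring_0 vec"
  shows "kronecker_vec u (b \<cdot>\<^sub>v v) = b \<cdot>\<^sub>v kronecker_vec u v"
  by (intro eq_vecI) (auto simp: kronecker_vec_def div_mod_less_mult mult_ac)

lemma kronecker_vec_neq_0: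
  fixes u v :: "'a::semiring_no_zero_divisors vec"
  assumes u: "u \<in> carrier_vec m" "u \<noteq> 0\<^sub>v m" and v: "v \<in> carrier_vec n" "v \<noteq> 0\<^sub>v n"
  shows "kronecker_vec u v \<noteq> 0\<^sub>v (m * n)"
proof -
  obtain i where i: "i < m" "u $ i \<noteq> 0"
    using u by (metis carrier_vecD eq_vecI index_zero_vec)
  obtain j where j: "j < n" "v $ j \<noteq> 0"
    using v by (metis carrier_vecD eq_vecI index_zero_vec)
  have "i * n + j < Suc i * n"
    using j by simp
  also have "\<dots> \<le> m * n"
    using i by (intro mult_right_mono) auto
  finally have p: "i * n + j < m * n" .
  then have "kronecker_vec u v $ (i * n + j) = u $ i * v $ j"
    using u v j by (simp add: kronecker_vec_def)
  with i j p show ?thesis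
    by auto
qed

definition kronecker_diff :: "'a::comm_ring_1 mat \<Rightarrow> 'a mat \<Rightarrow> 'a mat" where
  "kronecker_diff A B = kronecker_mat A (1\<^sub>m (dim_row B)) - kronecker_mat (1\<^sub>m (dim_row A)) B"

lemma kronecker_diff_carrier [simp]:
  "A \<in> carrier_mat m m \<Longrightarrow> B \<in> carrier_mat n n \<Longrightarrow> kronecker_diff A B \<in> carrier_mat (m * n) (m * n)"
  unfolding kronecker_diff_def by (intro minus_carrier_mat kronecker_mat_carrier) auto

lemma eigenvalue_kronecker_diff:
  fixes A B :: "'a::idom mat"
  assumes A: "A \<in> carrier_mat m m" and B: "B \<in> carrier_mat n n"
    and "eigenvalue A a" and "eigenvalue B b"
  shows "eigenvalue (kronecker_diff A B) (a - b)"
proof -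
  obtain u where u: "u \<in> carrier_vec m" "u \<noteq> 0\<^sub>v m" "A *\<^sub>v u = a \<cdot>\<^sub>v u"
    using assms by (auto simp: eigenvalue_def eigenvector_def)
  obtain v where v: "v \<in> carrier_vec n" "v \<noteq> 0\<^sub>v n" "B *\<^sub>v v = b \<cdot>\<^sub>v v"
    using assms by (auto simp: eigenvalue_def eigenvector_def)
  let ?w = "kronecker_vec u v"
  have "kronecker_diff A B *\<^sub>v ?w = kronecker_mat A (1\<^sub>m n) *\<^sub>v ?w - kronecker_mat (1\<^sub>m m) B *\<^sub>v ?w"
    unfolding kronecker_diff_def using A B u v
    by (subst minus_mult_distrib_mat_vec[of _ "m * n" "m * n"]) auto
  also have "kronecker_mat A (1\<^sub>m n) *\<^sub>v ?w = a \<cdot>\<^sub>v ?w"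
    using A u v
    by (simp add: kronecker_mat_mult_kronecker_vec[of _ m m _ n n] kronecker_vec_smult_left)
  also have "kronecker_mat (1\<^sub>m m) B *\<^sub>v ?w = b \<cdot>\<^sub>v ?w"
    using B u v
    by (simp add: kronecker_mat_mult_kronecker_vec[of _ m m _ n n] kronecker_vec_smult_right)
  also have "a \<cdot>\<^sub>v ?w - b \<cdot>\<^sub>v ?w = (a - b) \<cdot>\<^sub>v ?w"
    by (intro eq_vecI) (auto simp: left_diff_distrib)
  finally have "eigenvector (kronecker_diff A B) ?w (a - b)"
    unfolding eigenvector_def
    using carrier_matD(1)[OF kronecker_diff_carrier[OF A B]] u v kronecker_vec_neq_0[OF u(1,2) v(1,2)]
    by simp
  then show ?thesis
    by (auto simp: eigenvalue_def)
qed

abbreviation poly_mat :: "'a::comm_semiring_0 poly mat \<Rightarrow> 'a \<Rightarrow> 'a mat" where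
  "poly_mat M t \<equiv> map_mat (\<lambda>p. poly p t) M"

lemma poly_mat_kronecker_diff:
  fixes M N :: "'a::comm_ring_1 poly mat"
  assumes "M \<in> carrier_mat m m" and "N \<in> carrier_mat n n"
  shows "poly_mat (kronecker_diff M N) t = kronecker_diff (poly_mat M t) (poly_mat N t)"
  using assms
  by (intro eq_matI) (auto simp: kronecker_diff_def kronecker_mat_def div_mod_less_mult)

lemma poly2_char_poly:
  fixes M :: "'a::comm_ring_1 poly mat"
  assumes "M \<in> carrier_mat n n"
  shows "poly2 (char_poly M) t y = poly (char_poly (poly_mat M t)) y"
  using poly_hom.poly_map_poly[of t "char_poly M" "[:y:]"]
  by (simp add: poly2_def poly_hom.char_poly_hom[OF assms])

lemma algebraic_on_eigenvalue_diff:
  fixes M N :: "'a::field poly mat"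
  assumes M: "M \<in> carrier_mat m m" and N: "N \<in> carrier_mat n n"
    and eig: "\<And>t. t \<in> X \<Longrightarrow> eigenvalue (poly_mat M t) (a t)"
      "\<And>t. t \<in> X \<Longrightarrow> eigenvalue (poly_mat N t) (b t)"
  shows "algebraic_on X (\<lambda>t. a t - b t)"
  unfolding algebraic_on_def
proof (intro exI conjI ballI)
  let ?K = "kronecker_diff M N"
  have K: "?K \<in> carrier_mat (m * n) (m * n)"
    using M N by simp
  show "char_poly ?K \<noteq> 0"
    using degree_monic_char_poly[OF K] by auto
  fix t
  assume "t \<in> X"
  then have "eigenvalue (poly_mat ?K t) (a t - b t)"
    unfolding poly_mat_kronecker_diff[OF M N] using M N eig
    by (intro eigenvalue_kronecker_diff) auto
  then show "poly2 (char_poly ?K) t (a t - b t) = 0"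
    using K by (simp add: poly2_char_poly[OF K] eigenvalue_root_char_poly[of _ "m * n"])
qed

section \<open>The least eigenvalue of a symmetric matrix\<close>

definition l1_norm_mat :: "real mat \<Rightarrow> real" where
  "l1_norm_mat A = (\<Sum>i<dim_row A. \<Sum>j<dim_col A. \<bar>A $$ (i, j)\<bar>)"

lemma l1_norm_mat_nonneg: "0 \<le> l1_norm_mat A"
  by (simp add: l1_norm_mat_def sum_nonneg)

lemma real_scalar_prod_self_nonneg: "0 \<le> v \<bullet> v" for v :: "real vec"
  using conjugate_square_ge_0_vec[of v] by simp

lemma real_scalar_prod_self_pos: "v \<in> carrier_vec n \<Longrightarrow> v \<noteq> 0\<^sub>v n \<Longrightarrow> 0 < v \<bullet> v" for v :: "real vec"
  using conjugate_square_greater_0_vec[of v n] by simp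

lemma abs_quadratic_form_le:
  fixes A :: "real mat"
  assumes A: "A \<in> carrier_mat n n" and v: "v \<in> carrier_vec n"
  shows "\<bar>v \<bullet> (A *\<^sub>v v)\<bar> \<le> l1_norm_mat A * (v \<bullet> v)"
proof -
  have square_le: "(v $ i)\<^sup>2 \<le> v \<bullet> v" if "i < n" for i
    using that v unfolding scalar_prod_def
    by (auto simp: power2_eq_square intro!: member_le_sum[of i _ "\<lambda>i. v $ i * v $ i"])
  have prod_le: "\<bar>v $ i * v $ j\<bar> \<le> v \<bullet> v" if "i < n" "j < n" for i j
    using sum_squares_bound[of "\<bar>v $ i\<bar>" "\<bar>v $ j\<bar>"] square_le[OF that(1)] square_le[OF that(2)]
    by (simp add: abs_mult)
  have "v \<bullet> (A *\<^sub>v v) = (\<Sum>i<n. \<Sum>j<n. A $$ (i, j) * (v $ i * v $ j))"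
    using A v by (simp add: scalar_prod_def atLeast0LessThan sum_distrib_left mult_ac)
  also have "\<bar>\<dots>\<bar> \<le> (\<Sum>i<n. \<Sum>j<n. \<bar>A $$ (i, j) * (v $ i * v $ j)\<bar>)"
    by (intro order_trans[OF sum_abs] sum_mono sum_abs)
  also have "\<dots> \<le> (\<Sum>i<n. \<Sum>j<n. \<bar>A $$ (i, j)\<bar> * (v \<bullet> v))"
    unfolding abs_mult[of "A $$ _"] using prod_le by (intro sum_mono mult_left_mono) auto
  also have "\<dots> = l1_norm_mat A * (v \<bullet> v)"
    using A by (simp add: l1_norm_mat_def sum_distrib_right)
  finally show ?thesis .
qed

lemma mult_mat_vec_norm_le:
  fixes A :: "real mat"
  assumes A: "A \<in> carrier_mat m n" and v: "v \<in> carrier_vec n"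
  shows "(A *\<^sub>v v) \<bullet> (A *\<^sub>v v) \<le> l1_norm_mat (A\<^sup>T * A) * (v \<bullet> v)"
proof -
  have "(A *\<^sub>v v) \<bullet> (A *\<^sub>v v) = v \<bullet> ((A\<^sup>T * A) *\<^sub>v v)"
    using transpose_vec_mult_scalar[of "A\<^sup>T" n m "A *\<^sub>v v" v] A v by simp
  also have "\<dots> \<le> l1_norm_mat (A\<^sup>T * A) * (v \<bullet> v)"
    using abs_quadratic_form_le[of "A\<^sup>T * A" n v] A v by fastforce
  finally show ?thesis .
qed

lemma psd_mult_mat_vec_norm_le:
  fixes B :: "real mat"
  assumes B: "B \<in> carrier_mat n n" and sym: "B\<^sup>T = B"
    and psd: "\<And>u. u \<in> carrier_vec n \<Longrightarrow> 0 \<le> u \<bullet> (B *\<^sub>v u)"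
    and v: "v \<in> carrier_vec n"
  shows "(B *\<^sub>v v) \<bullet> (B *\<^sub>v v) \<le> (l1_norm_mat B + 1) * (v \<bullet> (B *\<^sub>v v))"
proof -
  define K where "K = l1_norm_mat B + 1"
  define w where "w = B *\<^sub>v v"
  have w: "w \<in> carrier_vec n"
    using B v by (simp add: w_def)
  have "K > 0"
    using l1_norm_mat_nonneg[of B] by (simp add: K_def)
  have cross: "v \<bullet> (B *\<^sub>v w) = w \<bullet> w"
    using transpose_vec_mult_scalar[OF B w v] by (simp add: sym w_def)
  \<comment> \<open>Positivity at \<open>w - K v\<close> gives the claim.\<close>
  have "w \<bullet> (B *\<^sub>v w) \<le> K * (w \<bullet> w)"
    using abs_quadratic_form_le[OF B w] real_scalar_prod_self_nonneg[of w]
    by (simp add: K_def distrib_right)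
  moreover have "0 \<le> (w - K \<cdot>\<^sub>v v) \<bullet> (B *\<^sub>v (w - K \<cdot>\<^sub>v v))"
    using v w by (intro psd) simp
  moreover have "(w - K \<cdot>\<^sub>v v) \<bullet> (B *\<^sub>v (w - K \<cdot>\<^sub>v v)) =
      w \<bullet> (B *\<^sub>v w) - 2 * K * (w \<bullet> w) + K * (K * (v \<bullet> w))"
  proof -
    have "B *\<^sub>v (w - K \<cdot>\<^sub>v v) = B *\<^sub>v w - K \<cdot>\<^sub>v w"
      using B v w by (simp add: mult_minus_distrib_mat_vec mult_mat_vec w_def)
    then show ?thesis
      using B v w cross
      by (simp add: minus_scalar_prod_distrib[of _ n] scalar_prod_minus_distrib[of _ n] algebra_simps)
  qed
  ultimately have "K * (w \<bullet> w) \<le> K * (K * (v \<bullet> w))"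
    by simp
  with \<open>K > 0\<close> show ?thesis
    unfolding K_def[symmetric] w_def[symmetric] by simp
qed

lemma psd_nonsingular_coercive:
  fixes B :: "real mat"
  assumes B: "B \<in> carrier_mat n n" and sym: "B\<^sup>T = B"
    and psd: "\<And>v. v \<in> carrier_vec n \<Longrightarrow> 0 \<le> v \<bullet> (B *\<^sub>v v)"
    and "det B \<noteq> 0"
  obtains \<delta> where "\<delta> > 0" and "\<And>v. v \<in> carrier_vec n \<Longrightarrow> \<delta> * (v \<bullet> v) \<le> v \<bullet> (B *\<^sub>v v)"
proof -
  obtain C where C: "C \<in> carrier_mat n n" and CB: "C * B = 1\<^sub>m n"
    using det_non_zero_imp_unit[OF B \<open>det B \<noteq> 0\<close>, of "()"] by (auto simp: Units_def ring_mat_def)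
  define K where "K = (l1_norm_mat (C\<^sup>T * C) + 1) * (l1_norm_mat B + 1)"
  have "K > 0"
    unfolding K_def using l1_norm_mat_nonneg by (intro mult_pos_pos add_nonneg_pos) auto
  have "v \<bullet> v \<le> K * (v \<bullet> (B *\<^sub>v v))" if v: "v \<in> carrier_vec n" for v
  proof -
    let ?w = "B *\<^sub>v v"
    have w: "?w \<in> carrier_vec n"
      using B v by simp
    have "v = C *\<^sub>v ?w"
      using B C CB v by (metis assoc_mult_mat_vec one_mult_mat_vec)
    then have "v \<bullet> v \<le> l1_norm_mat (C\<^sup>T * C) * (?w \<bullet> ?w)"
      using mult_mat_vec_norm_le[OF C w] by simp
    also have "\<dots> \<le> (l1_norm_mat (C\<^sup>T * C) + 1) * (?w \<bullet> ?w)"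
      using real_scalar_prod_self_nonneg[of ?w] by (simp add: distrib_right)
    also have "\<dots> \<le> K * (v \<bullet> (B *\<^sub>v v))"
      unfolding K_def mult.assoc using l1_norm_mat_nonneg[of "C\<^sup>T * C"]
      by (intro mult_left_mono psd_mult_mat_vec_norm_le[OF B sym psd v]) auto
    finally show ?thesis .
  qed
  with \<open>K > 0\<close> show thesis
    by (intro that[of "1 / K"]) (auto simp: field_simps)
qed

lemma smult_mat_mult_vec:
  fixes A :: "'a::comm_semiring_0 mat"
  assumes "A \<in> carrier_mat m n" and "v \<in> carrier_vec n"
  shows "(c \<cdot>\<^sub>m A) *\<^sub>v v = c \<cdot>\<^sub>v (A *\<^sub>v v)"
  using assms by (intro eq_vecI) auto

lemma quadratic_form_char_matrix:
  fixes A :: "'a::field mat"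
  assumes "A \<in> carrier_mat n n" and "v \<in> carrier_vec n"
  shows "v \<bullet> (char_matrix A c *\<^sub>v v) = v \<bullet> (A *\<^sub>v v) - c * (v \<bullet> v)"
proof -
  have "char_matrix A c *\<^sub>v v = A *\<^sub>v v + (- c) \<cdot>\<^sub>v v"
    using assms unfolding char_matrix_def
    by (subst add_mult_distrib_mat_vec[of _ n n]) (auto simp: smult_mat_mult_vec[of _ n n])
  then show ?thesis
    using assms by (simp add: scalar_prod_add_distrib[of _ n])
qed

lemma transpose_char_matrix:
  fixes A :: "'a::field mat"
  assumes "A \<in> carrier_mat n n"
  shows "(char_matrix A c)\<^sup>T = char_matrix A\<^sup>T c"
  using assms by (intro eq_matI) (auto simp: char_matrix_def)

lemma greatest_quadratic_form_lower_bound: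
  fixes A :: "real mat"
  assumes A: "A \<in> carrier_mat n n" and "n > 0"
  obtains m where "\<And>v. v \<in> carrier_vec n \<Longrightarrow> m * (v \<bullet> v) \<le> v \<bullet> (A *\<^sub>v v)"
    and "\<And>c. \<forall>v\<in>carrier_vec n. c * (v \<bullet> v) \<le> v \<bullet> (A *\<^sub>v v) \<Longrightarrow> c \<le> m"
proof -
  define C where "C = {c. \<forall>v\<in>carrier_vec n. c * (v \<bullet> v) \<le> v \<bullet> (A *\<^sub>v v)}"
  have "- l1_norm_mat A \<in> C"
    using abs_quadratic_form_le[OF A] by (force simp: C_def abs_le_iff)
  have "c \<le> unit_vec n 0 \<bullet> (A *\<^sub>v unit_vec n 0)" if "c \<in> C" for c
  proof -
    have "c * (unit_vec n 0 \<bullet> unit_vec n 0) \<le> unit_vec n 0 \<bullet> (A *\<^sub>v unit_vec n 0)"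
      using that unit_vec_carrier[of n 0] unfolding C_def by blast
    then show ?thesis
      using \<open>n > 0\<close> by simp
  qed
  then have "bdd_above C"
    by (rule bdd_aboveI)
  show thesis
  proof (rule that)
    fix v :: "real vec"
    assume v: "v \<in> carrier_vec n"
    show "Sup C * (v \<bullet> v) \<le> v \<bullet> (A *\<^sub>v v)"
    proof (cases "v = 0\<^sub>v n")
      case True
      then show ?thesis
        using A by simp
    next
      case False
      then have pos: "0 < v \<bullet> v"
        by (rule real_scalar_prod_self_pos[OF v])
      have "c \<le> (v \<bullet> (A *\<^sub>v v)) / (v \<bullet> v)" if "c \<in> C" for c
        using that v pos by (simp add: C_def pos_le_divide_eq)
      then have "Sup C \<le> (v \<bullet> (A *\<^sub>v v)) / (v \<bullet> v)"
        using \<open>- l1_norm_mat A \<in> C\<close> by (intro cSup_least) auto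
      with pos show ?thesis
        by (simp add: pos_le_divide_eq)
    qed
  next
    show "c \<le> Sup C" if "\<forall>v\<in>carrier_vec n. c * (v \<bullet> v) \<le> v \<bullet> (A *\<^sub>v v)" for c
      using that \<open>bdd_above C\<close> by (intro cSup_upper) (simp_all add: C_def)
  qed
qed

lemma symmetric_mat_least_eigenvalue:
  fixes A :: "real mat"
  assumes A: "A \<in> carrier_mat n n" and sym: "A\<^sup>T = A" and "n > 0"
  obtains m where "eigenvalue A m" and "\<And>v. v \<in> carrier_vec n \<Longrightarrow> m * (v \<bullet> v) \<le> v \<bullet> (A *\<^sub>v v)"
proof -
  obtain m where bound: "\<And>v. v \<in> carrier_vec n \<Longrightarrow> m * (v \<bullet> v) \<le> v \<bullet> (A *\<^sub>v v)"
    and greatest: "\<And>c. \<forall>v\<in>carrier_vec n. c * (v \<bullet> v) \<le> v \<bullet> (A *\<^sub>v v) \<Longrightarrow> c \<le> m"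
    using greatest_quadratic_form_lower_bound[OF A \<open>n > 0\<close>] by blast
  let ?B = "char_matrix A m"
  have "eigenvalue A m"
  proof (rule ccontr)
    assume "\<not> eigenvalue A m"
    then have "det ?B \<noteq> 0"
      by (simp add: eigenvalue_det[OF A])
    moreover have "?B\<^sup>T = ?B"
      by (simp add: transpose_char_matrix[OF A] sym)
    moreover have "0 \<le> v \<bullet> (?B *\<^sub>v v)" if "v \<in> carrier_vec n" for v
      using bound[OF that] by (simp add: quadratic_form_char_matrix[OF A that])
    ultimately obtain \<delta> where "\<delta> > 0"
      and \<delta>: "\<And>v. v \<in> carrier_vec n \<Longrightarrow> \<delta> * (v \<bullet> v) \<le> v \<bullet> (?B *\<^sub>v v)"
      using psd_nonsingular_coercive[OF char_matrix_closed[OF A]] by blast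
    have "m + \<delta> \<le> m"
      using \<delta> by (intro greatest) (force simp: quadratic_form_char_matrix[OF A] distrib_right)
    with \<open>\<delta> > 0\<close> show False
      by simp
  qed
  with bound show thesis
    using that by blast
qed

lemma lambda_min_in_spectrum:
  assumes "A \<in> carrier_mat n n" and "spectrum A \<noteq> {}"
  shows "lambda_min A \<in> spectrum A"
  unfolding lambda_min_def using assms by (intro Min_in card_finite_spectrum(1))

lemma lambda_min_le:
  assumes "A \<in> carrier_mat n n" and "e \<in> spectrum A"
  shows "lambda_min A \<le> e"
  unfolding lambda_min_def using assms by (intro Min_le card_finite_spectrum(1))

lemma eigenvalue_lambda_min:
  fixes A :: "real mat"
  assumes A: "A \<in> carrier_mat n n" and "A\<^sup>T = A" and "n > 0"
  shows "eigenvalue A (lambda_min A)"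
proof -
  obtain m where "eigenvalue A m"
    using symmetric_mat_least_eigenvalue[OF assms] .
  then have "spectrum A \<noteq> {}"
    by (auto simp: spectrum_def)
  then show ?thesis
    using lambda_min_in_spectrum[OF A] by (simp add: spectrum_def)
qed

lemma le_lambda_min_iff:
  fixes A :: "real mat"
  assumes A: "A \<in> carrier_mat n n" and "A\<^sup>T = A" and "n > 0"
  shows "c \<le> lambda_min A \<longleftrightarrow> (\<forall>v\<in>carrier_vec n. c * (v \<bullet> v) \<le> v \<bullet> (A *\<^sub>v v))"
proof (intro iffI ballI)
  fix v :: "real vec"
  assume "c \<le> lambda_min A" and v: "v \<in> carrier_vec n"
  obtain m where "eigenvalue A m" and bound: "m * (v \<bullet> v) \<le> v \<bullet> (A *\<^sub>v v)"
    using symmetric_mat_least_eigenvalue[OF assms] v by metis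
  then have "lambda_min A \<le> m"
    by (intro lambda_min_le[OF A]) (simp add: spectrum_def)
  with \<open>c \<le> lambda_min A\<close> have "c * (v \<bullet> v) \<le> m * (v \<bullet> v)"
    by (intro mult_right_mono real_scalar_prod_self_nonneg) simp
  with bound show "c * (v \<bullet> v) \<le> v \<bullet> (A *\<^sub>v v)"
    by simp
next
  assume bound: "\<forall>v\<in>carrier_vec n. c * (v \<bullet> v) \<le> v \<bullet> (A *\<^sub>v v)"
  obtain u where u: "u \<in> carrier_vec n" "u \<noteq> 0\<^sub>v n" "A *\<^sub>v u = lambda_min A \<cdot>\<^sub>v u"
    using eigenvalue_lambda_min[OF assms] A by (auto simp: eigenvalue_def eigenvector_def)
  then have "c * (u \<bullet> u) \<le> lambda_min A * (u \<bullet> u)"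
    using bound by force
  then show "c \<le> lambda_min A"
    using real_scalar_prod_self_pos[OF u(1,2)] by simp
qed

lemma lambda_min_le_add_l1_norm:
  fixes A B :: "real mat"
  assumes A: "A \<in> carrier_mat n n" "A\<^sup>T = A" and B: "B \<in> carrier_mat n n" "B\<^sup>T = B" and "n > 0"
  shows "lambda_min A \<le> lambda_min B + l1_norm_mat (A - B)"
proof -
  have "(lambda_min A - l1_norm_mat (A - B)) * (v \<bullet> v) \<le> v \<bullet> (B *\<^sub>v v)"
    if v: "v \<in> carrier_vec n" for v
  proof -
    have "lambda_min A * (v \<bullet> v) \<le> v \<bullet> (A *\<^sub>v v)"
      using le_lambda_min_iff[OF A \<open>n > 0\<close>] v by blast
    moreover have "v \<bullet> ((A - B) *\<^sub>v v) \<le> l1_norm_mat (A - B) * (v \<bullet> v)"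
      using abs_quadratic_form_le[OF minus_carrier_mat[OF B(1)] v, of A] by simp
    moreover have "v \<bullet> ((A - B) *\<^sub>v v) = v \<bullet> (A *\<^sub>v v) - v \<bullet> (B *\<^sub>v v)"
      using A B v by (simp add: minus_mult_distrib_mat_vec[of _ n n] scalar_prod_minus_distrib[of _ n])
    ultimately show ?thesis
      by (simp add: left_diff_distrib)
  qed
  then have "lambda_min A - l1_norm_mat (A - B) \<le> lambda_min B"
    by (simp add: le_lambda_min_iff[OF B \<open>n > 0\<close>])
  then show ?thesis
    by simp
qed

lemma l1_norm_mat_minus_commute:
  assumes "A \<in> carrier_mat m n" and "B \<in> carrier_mat m n"
  shows "l1_norm_mat (A - B) = l1_norm_mat (B - A)"
  using assms by (auto simp: l1_norm_mat_def abs_minus_commute intro!: sum.cong)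

lemma abs_lambda_min_diff_le:
  fixes A B :: "real mat"
  assumes A: "A \<in> carrier_mat n n" "A\<^sup>T = A" and B: "B \<in> carrier_mat n n" "B\<^sup>T = B" and "n > 0"
  shows "\<bar>lambda_min A - lambda_min B\<bar> \<le> l1_norm_mat (A - B)"
  using lambda_min_le_add_l1_norm[OF A B \<open>n > 0\<close>] lambda_min_le_add_l1_norm[OF B A \<open>n > 0\<close>]
    l1_norm_mat_minus_commute[OF A(1) B(1)]
  by simp

lemma continuous_on_lambda_min:
  fixes A :: "'a::topological_space \<Rightarrow> real mat"
  assumes A: "\<And>t. t \<in> X \<Longrightarrow> A t \<in> carrier_mat n n" and sym: "\<And>t. t \<in> X \<Longrightarrow> (A t)\<^sup>T = A t"
    and "n > 0"
    and cont: "\<And>i j. i < n \<Longrightarrow> j < n \<Longrightarrow> continuous_on X (\<lambda>t. A t $$ (i, j))"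
  shows "continuous_on X (\<lambda>t. lambda_min (A t))"
  unfolding continuous_on_def
proof
  fix t
  assume "t \<in> X"
  have "((\<lambda>s. \<Sum>i<n. \<Sum>j<n. \<bar>A s $$ (i, j) - A t $$ (i, j)\<bar>) \<longlongrightarrow> 0) (at t within X)"
    using cont \<open>t \<in> X\<close> unfolding continuous_on_def
    by (intro tendsto_null_sum tendsto_rabs_zero LIM_zero) auto
  moreover have "\<bar>lambda_min (A s) - lambda_min (A t)\<bar> \<le>
      (\<Sum>i<n. \<Sum>j<n. \<bar>A s $$ (i, j) - A t $$ (i, j)\<bar>)" if "s \<in> X" for s
    using abs_lambda_min_diff_le[OF A sym A sym \<open>n > 0\<close>] carrier_matD[OF A] that \<open>t \<in> X\<close>
    by (simp add: l1_norm_mat_def)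
  then have "\<forall>\<^sub>F s in at t within X. norm (lambda_min (A s) - lambda_min (A t)) \<le>
      norm (\<Sum>i<n. \<Sum>j<n. \<bar>A s $$ (i, j) - A t $$ (i, j)\<bar>) * 1"
    by (auto simp: eventually_at_filter intro!: always_eventually order_trans[OF _ abs_ge_self])
  ultimately have "((\<lambda>s. lambda_min (A s) - lambda_min (A t)) \<longlongrightarrow> 0) (at t within X)"
    by (rule tendsto_0_le)
  then show "((\<lambda>s. lambda_min (A s)) \<longlongrightarrow> lambda_min (A t)) (at t within X)"
    by (rule LIM_zero_cancel)
qed

lemma eigenvector_one_minus_smult_iff:
  fixes A :: "'a::field mat"
  assumes A: "A \<in> carrier_mat n n" and "c \<noteq> 0"
  shows "eigenvector (1\<^sub>m n - c \<cdot>\<^sub>m A) v (1 - c * e) \<longleftrightarrow> eigenvector A v e"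
proof -
  have "(1\<^sub>m n - c \<cdot>\<^sub>m A) *\<^sub>v v = (1 - c * e) \<cdot>\<^sub>v v \<longleftrightarrow> A *\<^sub>v v = e \<cdot>\<^sub>v v"
    if v: "v \<in> carrier_vec n"
  proof -
    have "(1\<^sub>m n - c \<cdot>\<^sub>m A) *\<^sub>v v = v - c \<cdot>\<^sub>v (A *\<^sub>v v)"
      using A v by (simp add: minus_mult_distrib_mat_vec[of _ n n] smult_mat_mult_vec[of _ n n])
    moreover have "v - c \<cdot>\<^sub>v (A *\<^sub>v v) = (1 - c * e) \<cdot>\<^sub>v v \<longleftrightarrow> A *\<^sub>v v = e \<cdot>\<^sub>v v"
      using A v \<open>c \<noteq> 0\<close> by (auto simp: vec_eq_iff algebra_simps)
    ultimately show ?thesis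
      by simp
  qed
  then show ?thesis
    using A by (auto simp: eigenvector_def)
qed

lemma spectrum_one_minus_smult:
  fixes A :: "'a::field mat"
  assumes "A \<in> carrier_mat n n" and "c \<noteq> 0"
  shows "spectrum (1\<^sub>m n - c \<cdot>\<^sub>m A) = (\<lambda>e. 1 - c * e) ` spectrum A"
proof -
  have iff: "1 - c * e \<in> spectrum (1\<^sub>m n - c \<cdot>\<^sub>m A) \<longleftrightarrow> e \<in> spectrum A" for e
    by (simp add: spectrum_def eigenvalue_def eigenvector_one_minus_smult_iff[OF assms])
  show ?thesis
  proof (intro equalityI subsetI)
    fix x
    assume "x \<in> spectrum (1\<^sub>m n - c \<cdot>\<^sub>m A)"
    moreover have x: "x = 1 - c * ((1 - x) / c)"
      using \<open>c \<noteq> 0\<close> by simp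
    ultimately have "(1 - x) / c \<in> spectrum A"
      using iff[of "(1 - x) / c"] by simp
    with x show "x \<in> (\<lambda>e. 1 - c * e) ` spectrum A"
      by (rule image_eqI)
  qed (use iff in auto)
qed

lemma lambda_max_one_minus_smult:
  assumes A: "A \<in> carrier_mat n n" and "spectrum A \<noteq> {}" and "c > 0"
  shows "lambda_max (1\<^sub>m n - c \<cdot>\<^sub>m A) = 1 - c * lambda_min A"
proof -
  have "finite (spectrum A)"
    using card_finite_spectrum[OF A] by blast
  then show ?thesis
    unfolding lambda_max_def spectrum_one_minus_smult[OF A less_imp_neq[OF \<open>c > 0\<close>, symmetric]]
    using lambda_min_in_spectrum[OF A \<open>spectrum A \<noteq> {}\<close>] lambda_min_le[OF A] \<open>c > 0\<close>
    by (intro Max_eqI) auto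
qed

section \<open>Comparison of the perturbed Laplacians\<close>

lemma lambda_min_poly_mat_sgn_eventually_constant:
  fixes M N :: "real poly mat"
  assumes M: "M \<in> carrier_mat m m" "M\<^sup>T = M" "m > 0"
    and N: "N \<in> carrier_mat n n" "N\<^sup>T = N" "n > 0"
  shows "\<exists>c. \<forall>\<^sub>F t in at_right a. sgn (lambda_min (poly_mat M t) - lambda_min (poly_mat N t)) = c"
proof (rule algebraic_on_sgn_eventually_constant)
  have continuous: "continuous_on X (\<lambda>t. lambda_min (poly_mat K t))"
    if "K \<in> carrier_mat k k" "K\<^sup>T = K" "k > 0" for K :: "real poly mat" and k X
    using that by (intro continuous_on_lambda_min[where n = k])
      (auto simp: map_mat_transpose intro!: continuous_intros)
  show "continuous_on {a<..<a + 1} (\<lambda>t. lambda_min (poly_mat M t) - lambda_min (poly_mat N t))"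
    by (intro continuous_on_diff continuous[OF M] continuous[OF N])
  have eigenvalue: "eigenvalue (poly_mat K t) (lambda_min (poly_mat K t))"
    if "K \<in> carrier_mat k k" "K\<^sup>T = K" "k > 0" for K :: "real poly mat" and k t
    using that by (intro eigenvalue_lambda_min[of _ k]) (auto simp: map_mat_transpose)
  show "algebraic_on {a<..<a + 1} (\<lambda>t. lambda_min (poly_mat M t) - lambda_min (poly_mat N t))"
    by (rule algebraic_on_eigenvalue_diff[OF M(1) N(1) eigenvalue[OF M] eigenvalue[OF N]])
qed simp

definition matrix_pencil :: "'a::comm_ring_1 mat \<Rightarrow> 'a mat \<Rightarrow> 'a poly mat" where
  "matrix_pencil A B = mat (dim_row A) (dim_col A) (\<lambda>ij. [:A $$ ij, - B $$ ij:])"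

lemma matrix_pencil_carrier: "A \<in> carrier_mat m n \<Longrightarrow> matrix_pencil A B \<in> carrier_mat m n"
  by (simp add: matrix_pencil_def)

lemma poly_mat_matrix_pencil:
  assumes "A \<in> carrier_mat m n" and "B \<in> carrier_mat m n"
  shows "poly_mat (matrix_pencil A B) t = A - t \<cdot>\<^sub>m B"
  using assms by (intro eq_matI) (auto simp: matrix_pencil_def)

lemma transpose_matrix_pencil:
  assumes "A \<in> carrier_mat m n" and "B \<in> carrier_mat m n"
  shows "(matrix_pencil A B)\<^sup>T = matrix_pencil A\<^sup>T B\<^sup>T"
  using assms by (intro eq_matI) (auto simp: matrix_pencil_def)

lemma laplacian_carrier: "laplacian n G \<in> carrier_mat n n"
  by (simp add: laplacian_def degree_mat_def adjacency_mat_def minus_carrier_mat)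

lemma transpose_laplacian:
  assumes "pair_graph G"
  shows "(laplacian n G)\<^sup>T = laplacian n G"
proof -
  interpret pair_graph G
    by fact
  have "(i, j) \<in> parcs G \<longleftrightarrow> (j, i) \<in> parcs G" for i j
    using arcs_symmetric by blast
  then show ?thesis
    by (intro eq_matI) (auto simp: laplacian_def degree_mat_def adjacency_mat_def)
qed

lemma sum_unit_outer_carrier: "sum_unit_outer n S \<in> carrier_mat n n"
  by (simp add: sum_unit_outer_def)

lemma transpose_sum_unit_outer: "(sum_unit_outer n S)\<^sup>T = sum_unit_outer n S"
  by (intro eq_matI) (auto simp: sum_unit_outer_def mult.commute)

definition laplacian_pencil :: "nat \<Rightarrow> nat pair_pre_digraph \<Rightarrow> nat set \<Rightarrow> real poly mat" where
  "laplacian_pencil n G S = matrix_pencil (laplacian n G) (sum_unit_outer n S)"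

lemma laplacian_pencil_carrier: "laplacian_pencil n G S \<in> carrier_mat n n"
  by (simp add: laplacian_pencil_def matrix_pencil_carrier laplacian_carrier)

lemma transpose_laplacian_pencil:
  assumes "pair_graph G"
  shows "(laplacian_pencil n G S)\<^sup>T = laplacian_pencil n G S"
  unfolding laplacian_pencil_def
  by (simp add: transpose_matrix_pencil[OF laplacian_carrier sum_unit_outer_carrier]
      transpose_laplacian[OF assms] transpose_sum_unit_outer)

lemma perturbed_laplacian_eq_poly_mat:
  "perturbed_laplacian n G \<epsilon> S = poly_mat (laplacian_pencil n G S) \<epsilon>"
  unfolding perturbed_laplacian_def laplacian_pencil_def
  by (rule poly_mat_matrix_pencil[OF laplacian_carrier sum_unit_outer_carrier, symmetric])

lemma perturbed_laplacian_carrier: "perturbed_laplacian n G \<epsilon> S \<in> carrier_mat n n"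
  by (simp add: perturbed_laplacian_eq_poly_mat laplacian_pencil_carrier)

lemma transpose_perturbed_laplacian:
  assumes "pair_graph G"
  shows "(perturbed_laplacian n G \<epsilon> S)\<^sup>T = perturbed_laplacian n G \<epsilon> S"
  by (simp add: perturbed_laplacian_eq_poly_mat map_mat_transpose
      transpose_laplacian_pencil[OF assms])

lemma lambda_min_perturbed_laplacian_sgn_eventually_constant:
  assumes "pair_graph G" and "n > 0"
  shows "\<exists>c. \<forall>\<^sub>F \<epsilon> in at_right 0.
    sgn (lambda_min (perturbed_laplacian n G \<epsilon> S) - lambda_min (perturbed_laplacian n G \<epsilon> T)) = c"
  unfolding perturbed_laplacian_eq_poly_mat
  using assms
  by (intro lambda_min_poly_mat_sgn_eventually_constant[of _ n _ n] laplacian_pencil_carrier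
      transpose_laplacian_pencil)

lemma perturbed_stochastic_mat_eq:
  assumes "\<tau> \<noteq> 0"
  shows "perturbed_stochastic_mat n G \<tau> \<epsilon> S = 1\<^sub>m n - \<tau> \<cdot>\<^sub>m perturbed_laplacian n G (\<epsilon> / \<tau>) S"
  using assms
  by (intro eq_matI) (auto simp: perturbed_stochastic_mat_def perturbed_laplacian_def
      stochastic_mat_def laplacian_def degree_mat_def adjacency_mat_def sum_unit_outer_def
      right_diff_distrib)

lemma lambda_max_perturbed_stochastic_mat:
  assumes "pair_graph G" and "n > 0" and "\<tau> > 0"
  shows "lambda_max (perturbed_stochastic_mat n G \<tau> \<epsilon> S) =
    1 - \<tau> * lambda_min (perturbed_laplacian n G (\<epsilon> / \<tau>) S)"
proof -
  have "spectrum (perturbed_laplacian n G (\<epsilon> / \<tau>) S) \<noteq> {}"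
    using eigenvalue_lambda_min[OF perturbed_laplacian_carrier
        transpose_perturbed_laplacian[OF \<open>pair_graph G\<close>] \<open>n > 0\<close>]
    by (auto simp: spectrum_def)
  then show ?thesis
    using \<open>\<tau> > 0\<close>
    by (simp add: perturbed_stochastic_mat_eq
        lambda_max_one_minus_smult[OF perturbed_laplacian_carrier])
qed

lemma eventually_less_iff_less_rescaled:
  fixes f :: "real \<Rightarrow> 'b \<Rightarrow> real"
  assumes const: "\<And>x y. x \<in> A \<Longrightarrow> y \<in> A \<Longrightarrow> \<exists>c. \<forall>\<^sub>F t in at_right 0. sgn (f t x - f t y) = c"
    and "finite A" and "\<tau> > 0"
  shows "\<forall>\<^sub>F t in at_right 0. \<forall>x\<in>A. \<forall>y\<in>A. f t x < f t y \<longleftrightarrow> f (t / \<tau>) x < f (t / \<tau>) y"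
proof (intro eventually_ball_finite \<open>finite A\<close> ballI)
  fix x y
  assume "x \<in> A" "y \<in> A"
  then obtain c where c: "\<forall>\<^sub>F t in at_right 0. sgn (f t x - f t y) = c"
    using const by blast
  have "(\<lambda>t. t / \<tau>) = (*) (1 / \<tau>)"
    by (simp add: fun_eq_iff)
  then have "filterlim (\<lambda>t. t / \<tau>) (at_right 0) (at_right 0)"
    using filtermap_times_pos_at_right[of "1 / \<tau>" 0] \<open>\<tau> > 0\<close> by (simp add: filterlim_def)
  with c have "\<forall>\<^sub>F t in at_right 0. sgn (f (t / \<tau>) x - f (t / \<tau>) y) = c"
    by (rule eventually_compose_filterlim)
  with c show "\<forall>\<^sub>F t in at_right 0. f t x < f t y \<longleftrightarrow> f (t / \<tau>) x < f (t / \<tau>) y"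
  proof eventually_elim
    case (elim t)
    have "f t x < f t y \<longleftrightarrow> c < 0"
      using elim(1) by (metis diff_less_0_iff_less sgn_less)
    also have "\<dots> \<longleftrightarrow> f (t / \<tau>) x < f (t / \<tau>) y"
      using elim(2) by (metis diff_less_0_iff_less sgn_less)
    finally show ?case .
  qed
qed

theorem theorem4:
  fixes n k :: nat and G :: "nat pair_pre_digraph" and \<tau> :: real
  assumes "pair_graph G" and "pverts G = {..<n}"
    and "0 < \<tau>" and "max_degree G = 0 \<or> \<tau> < 1 / real (max_degree G)"
    and "k < n"
  shows "\<exists>\<epsilon>\<^sub>0>0. \<forall>\<epsilon>::real. 0 < \<epsilon> \<and> \<epsilon> < \<epsilon>\<^sub>0 \<longrightarrow>
    {S. is_arg_max (\<lambda>S. lambda_min (perturbed_laplacian n G \<epsilon> S))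
          (\<lambda>S. S \<subseteq> {..<n} \<and> card S = k) S}
    = {S. is_arg_min (\<lambda>S. lambda_max (perturbed_stochastic_mat n G \<tau> \<epsilon> S))
          (\<lambda>S. S \<subseteq> {..<n} \<and> card S = k) S}"
proof -
  let ?f = "\<lambda>\<epsilon> S. lambda_min (perturbed_laplacian n G \<epsilon> S)"
  have "n > 0"
    using \<open>k < n\<close> by simp
  have "\<forall>\<^sub>F \<epsilon> in at_right 0. \<forall>S\<in>Pow {..<n}. \<forall>T\<in>Pow {..<n}.
      ?f \<epsilon> S < ?f \<epsilon> T \<longleftrightarrow> ?f (\<epsilon> / \<tau>) S < ?f (\<epsilon> / \<tau>) T"
    using lambda_min_perturbed_laplacian_sgn_eventually_constant[OF \<open>pair_graph G\<close> \<open>n > 0\<close>] \<open>0 < \<tau>\<close>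
    by (intro eventually_less_iff_less_rescaled) auto
  then have "\<forall>\<^sub>F \<epsilon> in at_right 0.
      {S. is_arg_max (?f \<epsilon>) (\<lambda>S. S \<subseteq> {..<n} \<and> card S = k) S}
      = {S. is_arg_min (\<lambda>S. lambda_max (perturbed_stochastic_mat n G \<tau> \<epsilon> S))
            (\<lambda>S. S \<subseteq> {..<n} \<and> card S = k) S}"
    by (rule eventually_mono)
      (use \<open>0 < \<tau>\<close> in \<open>auto simp: is_arg_max_def is_arg_min_def
        lambda_max_perturbed_stochastic_mat[OF \<open>pair_graph G\<close> \<open>n > 0\<close> \<open>0 < \<tau>\<close>]\<close>)
  then show ?thesis
    unfolding eventually_at_right_field by blast
qed

end
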